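(* Let $H=H^{(1)}\ge 2$ be an integer, let $W$ be an open subset of $\mathbf{R}^d$ and $w_0\in W$. For a fixed input $x$, let $y(w)=h(x,w)=(h_1(x,w),\dots,h_H(x,w))$ be a vector of real analytic functions of $w\in W$, with components $y_i(w)=h_i(x,w)$, and let $$\mathrm{Softmax}(y|x,w)=\Big(\frac{e^{y_1(w)}}{\sum_{i=1}^{H}e^{y_i(w)}},\dots,\frac{e^{y_H(w)}}{\sum_{i=1}^{H}e^{y_i(w)}}\Big).$$ Then, in the ring of real analytic functions of $w$ in a neighborhood of $w_0$, $$\langle \mathrm{Softmax}(y|x,w)-\mathrm{Softmax}(y|x,w_0)\rangle=\big\langle y_2(w)-y_1(w)-(y_2(w_0)-y_1(w_0)),\ \dots,\ y_H(w)-y_1(w)-(y_H(w_0)-y_1(w_0))\big\rangle .$$ Consequently, for the log canonical threshold over the real field, $$c_{w_0}\big(\|\mathrm{Softmax}(y|x,w)-\mathrm{Softmax}(y|x,w_0)\|^2\big)=c_{w_0}\left(\left\|\begin{pmatrix}h_2(x,w)-h_1(x,w)\\ h_3(x,w)-h_1(x,w)\\ \vdots\\ h_H(x,w)-h_1(x,w)\end{pmatrix}-\begin{pmatrix}h_2(x,w_0)-h_1(x,w_0)\\ h_3(x,w_0)-h_1(x,w_0)\\ \vdots\\ h_H(x,w_0)-h_1(x,w_0)\end{pmatrix}\right\|^2\right).$$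
   Context: For a vector or matrix $C$ of functions, $\langle C\rangle$ denotes the ideal generated by all entries of $C$, and $\|C\|=\sqrt{\sum|c_{ij}|^2}$. For a real analytic function $g$ near $w_0\in\mathbf{R}^d$, the log canonical threshold over the real field is $c_{w_0}(g)=\sup\{c:|g|^{-c}\text{ is locally }L^1\text{ in a neighborhood of }w_0\}$. *)

theory Defs
  imports "HOL-Analysis.Analysis" "HOL-Algebra.Ideal"
begin

text \<open>
  The library's \<^const>\<open>analytic_on\<close> concerns one complex variable. The power series below is
  indexed by multi-indices \<open>\<alpha> :: 'd \<Rightarrow> nat\<close> and summed unconditionally (equivalently, absolutely).
\<close>

definition real_analytic_at :: "(real ^ 'd \<Rightarrow> real) \<Rightarrow> real ^ 'd \<Rightarrow> bool" where
  "real_analytic_at f a \<longleftrightarrow>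
     (\<exists>(c :: ('d \<Rightarrow> nat) \<Rightarrow> real) r. r > 0 \<and>
        (\<forall>x\<in>ball a r. ((\<lambda>\<alpha>. c \<alpha> * (\<Prod>i\<in>UNIV. (x $ i - a $ i) ^ \<alpha> i)) has_sum f x) UNIV))"

definition real_analytic_on :: "(real ^ 'd \<Rightarrow> real) \<Rightarrow> (real ^ 'd) set \<Rightarrow> bool" where
  "real_analytic_on f W \<longleftrightarrow> (\<forall>a\<in>W. real_analytic_at f a)"

lemma real_analytic_at_const: "real_analytic_at (\<lambda>_. k) a"
proof -
  have "((\<lambda>\<alpha>::'a \<Rightarrow> nat. (if \<alpha> = (\<lambda>_. 0) then k else 0) * (\<Prod>i\<in>UNIV. (x $ i - a $ i) ^ \<alpha> i))
      has_sum k) UNIV" for x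
    by (rule has_sum_finite_neutralI[where B = "{\<lambda>_. 0}"]) auto
  then show ?thesis
    unfolding real_analytic_at_def
    by (intro exI[of _ "\<lambda>\<alpha>::'a \<Rightarrow> nat. if \<alpha> = (\<lambda>_. 0) then k else 0"] exI[of _ 1]) auto
qed

lemma real_analytic_at_add:
  assumes "real_analytic_at f a" "real_analytic_at g a"
  shows "real_analytic_at (\<lambda>x. f x + g x) a"
proof -
  obtain c r where c: "r > 0"
    "\<And>x. x \<in> ball a r \<Longrightarrow> ((\<lambda>\<alpha>. c \<alpha> * (\<Prod>i\<in>UNIV. (x $ i - a $ i) ^ \<alpha> i)) has_sum f x) UNIV"
    using assms(1) unfolding real_analytic_at_def by blast
  obtain e s where e: "s > 0"
    "\<And>x. x \<in> ball a s \<Longrightarrow> ((\<lambda>\<alpha>. e \<alpha> * (\<Prod>i\<in>UNIV. (x $ i - a $ i) ^ \<alpha> i)) has_sum g x) UNIV"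
    using assms(2) unfolding real_analytic_at_def by blast
  have "((\<lambda>\<alpha>. (c \<alpha> + e \<alpha>) * (\<Prod>i\<in>UNIV. (x $ i - a $ i) ^ \<alpha> i)) has_sum (f x + g x)) UNIV"
    if "x \<in> ball a (min r s)" for x
    unfolding distrib_right by (rule has_sum_add; rule c(2) e(2); use that in auto)
  with c(1) e(1) show ?thesis
    unfolding real_analytic_at_def
    by (intro exI[of _ "\<lambda>\<alpha>. c \<alpha> + e \<alpha>"] exI[of _ "min r s"]) auto
qed

lemma real_analytic_at_mult:
  fixes f g :: "real ^ 'd \<Rightarrow> real"
  assumes "real_analytic_at f a" "real_analytic_at g a"
  shows "real_analytic_at (\<lambda>x. f x * g x) a"
proof -
  obtain c r where c: "r > 0"
    "\<And>x. x \<in> ball a r \<Longrightarrow> ((\<lambda>\<alpha>. c \<alpha> * (\<Prod>i\<in>UNIV. (x $ i - a $ i) ^ \<alpha> i)) has_sum f x) UNIV"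
    using assms(1) unfolding real_analytic_at_def by blast
  obtain e s where e: "s > 0"
    "\<And>x. x \<in> ball a s \<Longrightarrow> ((\<lambda>\<alpha>. e \<alpha> * (\<Prod>i\<in>UNIV. (x $ i - a $ i) ^ \<alpha> i)) has_sum g x) UNIV"
    using assms(2) unfolding real_analytic_at_def by blast
  define B where "B \<gamma> = {\<beta> :: 'd \<Rightarrow> nat. \<forall>i. \<beta> i \<le> \<gamma> i}" for \<gamma>
  define q where "q \<gamma> = (\<Sum>\<beta>\<in>B \<gamma>. c (\<lambda>i. \<gamma> i - \<beta> i) * e \<beta>)" for \<gamma>
  have finB: "finite (B \<gamma>)" for \<gamma>
  proof -
    have "B \<gamma> = PiE UNIV (\<lambda>i. {..\<gamma> i})" by (auto simp: B_def PiE_def Pi_def)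
    then show ?thesis by (simp add: finite_PiE)
  qed
  have "((\<lambda>\<gamma>. q \<gamma> * (\<Prod>i\<in>UNIV. (x $ i - a $ i) ^ \<gamma> i)) has_sum (f x * g x)) UNIV"
    if x: "x \<in> ball a (min r s)" for x
  proof -
    define M where "M \<alpha> = (\<Prod>i\<in>UNIV. (x $ i - a $ i) ^ \<alpha> i)" for \<alpha> :: "'d \<Rightarrow> nat"
    have F: "((\<lambda>\<alpha>. c \<alpha> * M \<alpha>) has_sum f x) UNIV" and G: "((\<lambda>\<alpha>. e \<alpha> * M \<alpha>) has_sum g x) UNIV"
      using c(2) e(2) x unfolding M_def by auto
    have absF: "(\<lambda>\<alpha>. norm (c \<alpha> * M \<alpha>)) summable_on UNIV"
      and absG: "(\<lambda>\<alpha>. norm (e \<alpha> * M \<alpha>)) summable_on UNIV"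
      by (rule iffD1[OF summable_on_iff_abs_summable_on_real has_sum_imp_summable[OF F]]
          iffD1[OF summable_on_iff_abs_summable_on_real has_sum_imp_summable[OF G]])+
    have "(\<lambda>p. norm ((c (fst p) * M (fst p)) * (e (snd p) * M (snd p)))) summable_on (UNIV \<times> UNIV)"
      unfolding Infinite_Sum.abs_summable_on_Sigma_iff
    proof (intro conjI ballI, goal_cases)
      case (1 \<alpha>)
      have "(\<lambda>\<beta>. norm (c \<alpha> * M \<alpha>) * norm (e \<beta> * M \<beta>)) summable_on UNIV"
        by (rule summable_on_cmult_right[OF absG])
      then show ?case by (simp add: abs_mult)
    next
      case 2
      have "(\<lambda>\<alpha>. norm (c \<alpha> * M \<alpha>) * (\<Sum>\<^sub>\<infinity>\<beta>. norm (e \<beta> * M \<beta>))) summable_on UNIV"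
        by (rule summable_on_cmult_left[OF absF])
      moreover have "(\<Sum>\<^sub>\<infinity>\<beta>. norm (c \<alpha> * M \<alpha> * (e \<beta> * M \<beta>)))
          = norm (c \<alpha> * M \<alpha>) * (\<Sum>\<^sub>\<infinity>\<beta>. norm (e \<beta> * M \<beta>))" for \<alpha>
        unfolding norm_mult[of "c \<alpha> * M \<alpha>"] by (rule infsum_cmult_right')
      ultimately show ?case
        unfolding fst_conv snd_conv by (intro iffD1[OF summable_on_iff_abs_summable_on_real]) simp
    qed
    then have S: "(\<lambda>p. (c (fst p) * M (fst p)) * (e (snd p) * M (snd p))) summable_on (UNIV \<times> UNIV)"
      by (rule iffD2[OF summable_on_iff_abs_summable_on_real])
    have P: "((\<lambda>p. (c (fst p) * M (fst p)) * (e (snd p) * M (snd p))) has_sum (f x * g x))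
        (UNIV \<times> UNIV)"
      by (rule has_sum_SigmaI[OF _ has_sum_cmult_left[OF F] S])
        (unfold fst_conv snd_conv, rule has_sum_cmult_right[OF G])
    have "((\<lambda>p. (c (fst p) * M (fst p)) * (e (snd p) * M (snd p))) has_sum (f x * g x)) (UNIV \<times> UNIV)
      \<longleftrightarrow> ((\<lambda>(\<gamma>,\<beta>). c (\<lambda>i. \<gamma> i - \<beta> i) * e \<beta> * M \<gamma>) has_sum (f x * g x)) (Sigma UNIV B)"
      by (rule has_sum_reindex_bij_witness[
            where i = "\<lambda>(\<gamma>,\<beta>). (\<lambda>i. \<gamma> i - \<beta> i, \<beta>)" and j = "\<lambda>(\<alpha>,\<beta>). (\<lambda>i. \<alpha> i + \<beta> i, \<beta>)"])
        (auto simp: B_def M_def power_add prod.distrib ac_simps)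
    with P have "((\<lambda>(\<gamma>,\<beta>). c (\<lambda>i. \<gamma> i - \<beta> i) * e \<beta> * M \<gamma>) has_sum (f x * g x)) (Sigma UNIV B)"
      by blast
    then have "((\<lambda>\<gamma>. \<Sum>\<beta>\<in>B \<gamma>. c (\<lambda>i. \<gamma> i - \<beta> i) * e \<beta> * M \<gamma>) has_sum (f x * g x)) UNIV"
      by (rule has_sum_SigmaD) (simp add: finB)
    then show ?thesis
      by (simp add: q_def M_def sum_distrib_right)
  qed
  with c(1) e(1) show ?thesis
    unfolding real_analytic_at_def by (intro exI[of _ q] exI[of _ "min r s"]) auto
qed

definition germ :: "real ^ 'd \<Rightarrow> (real ^ 'd \<Rightarrow> real) \<Rightarrow> (real ^ 'd \<Rightarrow> real) set" where
  "germ a f = {g. eventually (\<lambda>w. g w = f w) (nhds a)}"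

definition analytic_germs :: "real ^ 'd \<Rightarrow> (real ^ 'd \<Rightarrow> real) set ring" where
  "analytic_germs a =
     \<lparr>carrier = germ a ` {f. real_analytic_at f a},
      mult = (\<lambda>A B. \<Union>f\<in>A. \<Union>g\<in>B. germ a (\<lambda>w. f w * g w)),
      one = germ a (\<lambda>_. 1),
      zero = germ a (\<lambda>_. 0),
      add = (\<lambda>A B. \<Union>f\<in>A. \<Union>g\<in>B. germ a (\<lambda>w. f w + g w))\<rparr>"

lemma germ_self: "f \<in> germ a f"
  by (simp add: germ_def)

lemma germ_cong: "eventually (\<lambda>w. f w = g w) (nhds a) \<Longrightarrow> germ a f = germ a g"
  unfolding germ_def by (auto elim: eventually_elim2)

lemma germ_eq_iff: "germ a f = germ a g \<longleftrightarrow> eventually (\<lambda>w. f w = g w) (nhds a)"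
proof
  assume "germ a f = germ a g"
  then have "f \<in> germ a g" using germ_self[of f a] by simp
  then show "eventually (\<lambda>w. f w = g w) (nhds a)" by (simp add: germ_def)
qed (rule germ_cong)

lemma germ_mult:
  "germ a f \<otimes>\<^bsub>analytic_germs a\<^esub> germ a g = germ a (\<lambda>w. f w * g w)"
proof -
  have "germ a (\<lambda>w. f' w * g' w) = germ a (\<lambda>w. f w * g w)"
    if "f' \<in> germ a f" "g' \<in> germ a g" for f' g'
    by (rule germ_cong, rule eventually_elim2[OF that[unfolded germ_def mem_Collect_eq]]) simp
  then have "(\<Union>f'\<in>germ a f. \<Union>g'\<in>germ a g. germ a (\<lambda>w. f' w * g' w))
      = (\<Union>f'\<in>germ a f. \<Union>g'\<in>germ a g. germ a (\<lambda>w. f w * g w))"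
    by (intro SUP_cong refl)
  also have "\<dots> = germ a (\<lambda>w. f w * g w)"
    using germ_self[of f a] germ_self[of g a] by (simp only: UN_constant split: if_splits) blast
  finally show ?thesis by (simp add: analytic_germs_def)
qed

lemma germ_add:
  "germ a f \<oplus>\<^bsub>analytic_germs a\<^esub> germ a g = germ a (\<lambda>w. f w + g w)"
proof -
  have "germ a (\<lambda>w. f' w + g' w) = germ a (\<lambda>w. f w + g w)"
    if "f' \<in> germ a f" "g' \<in> germ a g" for f' g'
    by (rule germ_cong, rule eventually_elim2[OF that[unfolded germ_def mem_Collect_eq]]) simp
  then have "(\<Union>f'\<in>germ a f. \<Union>g'\<in>germ a g. germ a (\<lambda>w. f' w + g' w))
      = (\<Union>f'\<in>germ a f. \<Union>g'\<in>germ a g. germ a (\<lambda>w. f w + g w))"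
    by (intro SUP_cong refl)
  also have "\<dots> = germ a (\<lambda>w. f w + g w)"
    using germ_self[of f a] germ_self[of g a] by (simp only: UN_constant split: if_splits) blast
  finally show ?thesis by (simp add: analytic_germs_def)
qed

lemma germ_zero: "\<zero>\<^bsub>analytic_germs a\<^esub> = germ a (\<lambda>_. 0)"
  and germ_one: "\<one>\<^bsub>analytic_germs a\<^esub> = germ a (\<lambda>_. 1)"
  and carrier_analytic_germs: "carrier (analytic_germs a) = germ a ` {f. real_analytic_at f a}"
  by (simp_all add: analytic_germs_def)

text \<open>
  \<^const>\<open>genideal\<close> intersects the ideals containing a set, and \<^const>\<open>ideal\<close> presupposes a ring:
  the following lemma is what makes generated ideals in \<^const>\<open>analytic_germs\<close> meaningful.
\<close>

lemma cring_analytic_germs: "cring (analytic_germs a)"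
proof (rule cringI)
  show "abelian_group (analytic_germs a)"
  proof (rule abelian_groupI)
    fix x assume "x \<in> carrier (analytic_germs a)"
    then obtain f where f: "x = germ a f" "real_analytic_at f a"
      by (auto simp: carrier_analytic_germs)
    have "real_analytic_at (\<lambda>w. (-1) * f w) a"
      by (rule real_analytic_at_mult[OF real_analytic_at_const f(2)])
    then show "\<exists>y\<in>carrier (analytic_germs a). y \<oplus>\<^bsub>analytic_germs a\<^esub> x = \<zero>\<^bsub>analytic_germs a\<^esub>"
      by (intro bexI[of _ "germ a (\<lambda>w. (-1) * f w)"])
        (auto simp: f(1) germ_add germ_zero carrier_analytic_germs)
  qed (auto simp: carrier_analytic_germs germ_add germ_zero ac_simps
      intro!: imageI real_analytic_at_add real_analytic_at_const)
  show "comm_monoid (analytic_germs a)"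
    by (rule comm_monoidI)
      (auto simp: carrier_analytic_germs germ_mult germ_one ac_simps
        intro!: imageI real_analytic_at_mult real_analytic_at_const)
qed (auto simp: carrier_analytic_germs germ_add germ_mult distrib_right)

text \<open>
  \<open>|g|\<^sup>-\<^sup>c\<close> takes the value \<open>\<infinity>\<close> at zeros of \<open>g\<close> when \<open>c > 0\<close>; \<^const>\<open>powr\<close> alone would give 0 there
  and make the threshold of the zero function infinite. All real \<open>c\<close> are admitted, and the
  supremum is taken in the extended reals: it is \<open>\<infinity>\<close> if \<open>g w\<^sub>0 \<noteq> 0\<close> and 0 if \<open>g\<close> vanishes near \<open>w\<^sub>0\<close>.
\<close>

definition abs_neg_power :: "real \<Rightarrow> real \<Rightarrow> ennreal" where
  "abs_neg_power c t =
     (if t \<noteq> 0 then ennreal (\<bar>t\<bar> powr (- c)) else if c > 0 then \<infinity> else if c = 0 then 1 else 0)"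

definition locally_L1_on :: "(real ^ 'd) set \<Rightarrow> (real ^ 'd \<Rightarrow> ennreal) \<Rightarrow> bool" where
  "locally_L1_on U f \<longleftrightarrow>
     (\<forall>K. compact K \<and> K \<subseteq> U \<longrightarrow>
        (\<lambda>w. f w * indicator K w) \<in> borel_measurable lebesgue \<and>
        (\<integral>\<^sup>+ w. f w * indicator K w \<partial>lebesgue) < \<infinity>)"

definition lct :: "real ^ 'd \<Rightarrow> (real ^ 'd \<Rightarrow> real) \<Rightarrow> ereal" where
  "lct w0 g =
     Sup {ereal c | c. \<exists>U. open U \<and> w0 \<in> U \<and> locally_L1_on U (\<lambda>w. abs_neg_power c (g w))}"

definition softmax :: "nat \<Rightarrow> (nat \<Rightarrow> real) \<Rightarrow> nat \<Rightarrow> real" where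
  "softmax H y i = exp (y i) / (\<Sum>j=1..H. exp (y j))"

end

theory Submission
  imports Defs
begin

text \<open>
  Write \<open>p\<close> and \<open>s\<close> for the softmax vectors at \<open>w\<^sub>0\<close> and at \<open>w\<close>, and let
  \<open>z\<^sub>i = y\<^sub>i(w) - y\<^sub>1(w) - (y\<^sub>i(w\<^sub>0) - y\<^sub>1(w\<^sub>0))\<close>. Then \<open>s\<^sub>i = p\<^sub>i exp z\<^sub>i / S\<close> with
  \<open>S = \<Sum> p\<^sub>j exp z\<^sub>j\<close>. Since \<open>exp t - 1 = \<phi>(t) t\<close> with \<open>\<phi>\<close> analytic and nowhere zero, each
  \<open>s\<^sub>i - p\<^sub>i\<close> is an analytic linear combination of the \<open>z\<^sub>j\<close>. Conversely \<open>\<phi>(z\<^sub>i) z\<^sub>i\<close> equals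
  \<open>p\<^sub>1 s\<^sub>i / (p\<^sub>i s\<^sub>1) - 1\<close>, which is linear in the differences \<open>s\<^sub>j - p\<^sub>j\<close> up to a unit. Analytic
  coefficients are locally bounded, so the two sums of squares dominate each other near \<open>w\<^sub>0\<close> up to
  a constant factor, and this determines the log canonical threshold.
\<close>

subsection \<open>Composition with power series in one variable\<close>

lemma has_sum_imp_abs_summable_on:
  fixes f :: "'a \<Rightarrow> real"
  assumes "(f has_sum s) A"
  shows "(\<lambda>x. \<bar>f x\<bar>) summable_on A"
  using iffD1[OF summable_on_iff_abs_summable_on_real has_sum_imp_summable[OF assms]] by simp

lemma abs_summable_on_imp_summable_on:
  fixes f :: "'a \<Rightarrow> real"
  assumes "(\<lambda>x. \<bar>f x\<bar>) summable_on A"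
  shows "f summable_on A"
  by (rule iffD2[OF summable_on_iff_abs_summable_on_real]) (use assms in simp)

text \<open>Real sums are automatically absolute, so the product of the two absolute sums bounds the
  double sum and Fubini applies.\<close>

lemma has_sum_times_real:
  fixes f :: "'a \<Rightarrow> real" and g :: "'b \<Rightarrow> real"
  assumes f: "(f has_sum s) A" and g: "(g has_sum t) B"
  shows "((\<lambda>(x, y). f x * g y) has_sum s * t) (A \<times> B)"
proof -
  have absf: "(\<lambda>x. \<bar>f x\<bar>) summable_on A" and absg: "(\<lambda>y. \<bar>g y\<bar>) summable_on B"
    by (rule has_sum_imp_abs_summable_on[OF f] has_sum_imp_abs_summable_on[OF g])+
  have "(\<lambda>(x, y). \<bar>f x\<bar> * \<bar>g y\<bar>) summable_on (A \<times> B)"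
  proof (rule summable_on_SigmaI)
    show "((\<lambda>y. case (x, y) of (x, y) \<Rightarrow> \<bar>f x\<bar> * \<bar>g y\<bar>) has_sum \<bar>f x\<bar> * (\<Sum>\<^sub>\<infinity>y\<in>B. \<bar>g y\<bar>)) B" for x
      unfolding prod.case by (rule has_sum_cmult_right[OF has_sum_infsum[OF absg]])
    show "(\<lambda>x. \<bar>f x\<bar> * (\<Sum>\<^sub>\<infinity>y\<in>B. \<bar>g y\<bar>)) summable_on A"
      by (rule summable_on_cmult_left[OF absf])
  qed simp
  then have "(\<lambda>(x, y). f x * g y) summable_on (A \<times> B)"
    by - (rule abs_summable_on_imp_summable_on, simp add: case_prod_unfold abs_mult)
  then show ?thesis
  proof (rule has_sum_SigmaI[rotated 2])
    show "((\<lambda>y. case (x, y) of (x, y) \<Rightarrow> f x * g y) has_sum f x * t) B" for x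
      unfolding prod.case by (rule has_sum_cmult_right[OF g])
    show "((\<lambda>x. f x * t) has_sum s * t) A"
      by (rule has_sum_cmult_left[OF f])
  qed
qed

text \<open>Expands a power of a series by distributivity without collecting like terms: the words
  of length \<open>n\<close> index the products, and adjoining a head letter is the induction
  step.\<close>

lemma has_sum_prod_list_power:
  fixes u :: "'a \<Rightarrow> real"
  assumes u: "(u has_sum s) UNIV"
  shows "((\<lambda>L. prod_list (map u L)) has_sum s ^ n) {L. length L = n}"
proof (induction n)
  case 0
  have "{L :: 'a list. length L = 0} = {[]}" by auto
  then show ?case by (simp add: has_sum_finite_iff)
next
  case (Suc n)
  have "((\<lambda>(x, L). u x * prod_list (map u L)) has_sum s * s ^ n) (UNIV \<times> {L. length L = n})"
    by (rule has_sum_times_real[OF u Suc])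
  also have "?this \<longleftrightarrow> ((\<lambda>L. prod_list (map u L)) has_sum s * s ^ n) {L. length L = Suc n}"
    by (rule has_sum_reindex_bij_witness[where i = "\<lambda>L. (hd L, tl L)" and j = "\<lambda>(x, L). x # L"])
      (auto simp: length_Suc_conv)
  finally show ?case by simp
qed

text \<open>Passing from the point \<open>a + (\<rho>, \<dots>, \<rho>)\<close> to the polydisc of radius \<open>t * \<rho>\<close> gains a factor
  \<open>t\<close>, because the constant term has been removed.\<close>

lemma real_analytic_at_majorant:
  fixes f :: "real ^ 'd \<Rightarrow> real"
  assumes "real_analytic_at f a"
  shows "\<exists>\<rho>>0. \<exists>G\<ge>0. \<exists>c. \<forall>t\<in>{0..1}. \<forall>x. (\<forall>i. \<bar>x $ i - a $ i\<bar> \<le> t * \<rho>) \<longrightarrow>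
       ((\<lambda>\<alpha>. c \<alpha> * (\<Prod>i\<in>UNIV. (x $ i - a $ i) ^ \<alpha> i)) has_sum (f x - f a)) UNIV \<and>
       (\<Sum>\<^sub>\<infinity>\<alpha>. \<bar>c \<alpha> * (\<Prod>i\<in>UNIV. (x $ i - a $ i) ^ \<alpha> i)\<bar>) \<le> t * G"
proof -
  define M where "M x \<alpha> = (\<Prod>i\<in>UNIV. (x $ i - a $ i) ^ \<alpha> i)" for x and \<alpha> :: "'d \<Rightarrow> nat"
  obtain b r where r: "r > 0" and b: "\<And>x. x \<in> ball a r \<Longrightarrow> ((\<lambda>\<alpha>. b \<alpha> * M x \<alpha>) has_sum f x) UNIV"
    using assms unfolding real_analytic_at_def M_def by blast
  \<comment> \<open>The factor \<open>CARD('d)\<close> comes from the l1 bound on the norm, and the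
    2 makes inclusion of the closed cube of half-side \<open>\<rho>\<close> in the open ball
    strict.\<close>
  define \<rho> where "\<rho> = r / (2 * real CARD('d))"
  have \<rho>: "\<rho> > 0" using r by (simp add: \<rho>_def)
  have in_ball: "x \<in> ball a r" if "\<And>i. \<bar>x $ i - a $ i\<bar> \<le> \<rho>" for x
  proof -
    have "norm (x - a) \<le> (\<Sum>i\<in>UNIV. \<bar>(x - a) $ i\<bar>)" by (rule norm_le_l1_cart)
    also have "\<dots> \<le> (\<Sum>i\<in>(UNIV :: 'd set). \<rho>)" by (rule sum_mono) (use that in simp)
    also have "\<dots> < r" using r by (simp add: \<rho>_def)
    finally show ?thesis by (simp add: dist_norm norm_minus_commute)
  qed
  define c where "c \<alpha> = (if \<alpha> = (\<lambda>_. 0) then 0 else b \<alpha>)" for \<alpha>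
  \<comment> \<open>At \<open>a\<close> every monomial except the constant one vanishes, so
    uniqueness of sums identifies the constant coefficient with \<open>f a\<close>.\<close>
  have "((\<lambda>\<alpha>. b \<alpha> * M a \<alpha>) has_sum b (\<lambda>_. 0)) UNIV"
    by (rule has_sum_finite_neutralI[where B = "{\<lambda>_. 0}"]) (auto simp: M_def fun_eq_iff)
  moreover have "((\<lambda>\<alpha>. b \<alpha> * M a \<alpha>) has_sum f a) UNIV" using b[of a] r by simp
  ultimately have b0: "b (\<lambda>_. 0) = f a" by (rule has_sum_unique)
  have c: "((\<lambda>\<alpha>. c \<alpha> * M x \<alpha>) has_sum (f x - f a)) UNIV" if "x \<in> ball a r" for x
  proof -
    have "((\<lambda>\<alpha>. if \<alpha> = (\<lambda>_. 0) then - f a else 0) has_sum - f a) (UNIV :: ('d \<Rightarrow> nat) set)"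
      by (rule has_sum_finite_neutralI[where B = "{\<lambda>_. 0}"]) auto
    from has_sum_add[OF b[OF that] this]
    have "((\<lambda>\<alpha>. b \<alpha> * M x \<alpha> + (if \<alpha> = (\<lambda>_. 0) then - f a else 0)) has_sum (f x - f a)) UNIV" by simp
    also have "(\<lambda>\<alpha>. b \<alpha> * M x \<alpha> + (if \<alpha> = (\<lambda>_. 0) then - f a else 0)) = (\<lambda>\<alpha>. c \<alpha> * M x \<alpha>)"
    proof
      show "b \<alpha> * M x \<alpha> + (if \<alpha> = (\<lambda>_. 0) then - f a else 0) = c \<alpha> * M x \<alpha>" for \<alpha>
        by (cases "\<alpha> = (\<lambda>_. 0)") (simp_all add: c_def M_def b0)
    qed
    finally show ?thesis .
  qed
  \<comment> \<open>The corner of the cube, where every monomial attains its largest absolute value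
    over the cube.\<close>
  define v where "v = (\<chi> i. a $ i + \<rho>)"
  define G where "G = (\<Sum>\<^sub>\<infinity>\<alpha>. \<bar>c \<alpha> * M v \<alpha>\<bar>)"
  have v: "v \<in> ball a r" by (rule in_ball) (use \<rho> in \<open>simp add: v_def\<close>)
  have abs_v: "(\<lambda>\<alpha>. \<bar>c \<alpha> * M v \<alpha>\<bar>) summable_on UNIV"
    by (rule has_sum_imp_abs_summable_on[OF c[OF v]])
  have bound: "(\<Sum>\<^sub>\<infinity>\<alpha>. \<bar>c \<alpha> * M x \<alpha>\<bar>) \<le> t * G"
    if t: "0 \<le> t" "t \<le> 1" and x: "\<forall>i. \<bar>x $ i - a $ i\<bar> \<le> t * \<rho>" "x \<in> ball a r" for x t
  proof -
    have "\<bar>c \<alpha> * M x \<alpha>\<bar> \<le> t * \<bar>c \<alpha> * M v \<alpha>\<bar>" for \<alpha>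
    proof (cases "\<alpha> = (\<lambda>_. 0)")
      case False
      then obtain k where "\<alpha> k \<noteq> 0" by auto
      then have pos: "(\<Sum>i\<in>UNIV. \<alpha> i) \<noteq> 0" by auto
      have "\<bar>M x \<alpha>\<bar> = (\<Prod>i\<in>UNIV. \<bar>x $ i - a $ i\<bar> ^ \<alpha> i)"
        by (simp add: M_def abs_prod power_abs)
      also have "\<dots> \<le> (\<Prod>i\<in>UNIV. (t * \<rho>) ^ \<alpha> i)"
        by (intro prod_mono conjI power_mono x[rule_format]) auto
      also have "\<dots> = t ^ (\<Sum>i\<in>UNIV. \<alpha> i) * M v \<alpha>"
        by (simp add: M_def v_def power_mult_distrib prod.distrib power_sum)
      \<comment> \<open>The total degree is at least 1 and \<open>t \<le> 1\<close>, so one factor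
        \<open>t\<close> survives.\<close>
      also have "\<dots> \<le> t * M v \<alpha>"
        using power_decreasing[of 1 "\<Sum>i\<in>UNIV. \<alpha> i" t] t pos \<rho>
        by (intro mult_right_mono) (auto simp: M_def v_def intro!: prod_nonneg)
      also have "\<dots> \<le> t * \<bar>M v \<alpha>\<bar>" using t by (intro mult_left_mono) auto
      finally have "\<bar>c \<alpha>\<bar> * \<bar>M x \<alpha>\<bar> \<le> \<bar>c \<alpha>\<bar> * (t * \<bar>M v \<alpha>\<bar>)"
        by (rule mult_left_mono) simp
      then show ?thesis by (simp add: abs_mult ac_simps)
    qed (simp add: c_def)
    then have "(\<Sum>\<^sub>\<infinity>\<alpha>. \<bar>c \<alpha> * M x \<alpha>\<bar>) \<le> (\<Sum>\<^sub>\<infinity>\<alpha>. t * \<bar>c \<alpha> * M v \<alpha>\<bar>)"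
      by (intro infsum_mono summable_on_cmult_right abs_v has_sum_imp_abs_summable_on[OF c[OF x(2)]])
    then show ?thesis by (simp add: infsum_cmult_right' G_def)
  qed
  have "((\<lambda>\<alpha>. c \<alpha> * (\<Prod>i\<in>UNIV. (x $ i - a $ i) ^ \<alpha> i)) has_sum (f x - f a)) UNIV \<and>
       (\<Sum>\<^sub>\<infinity>\<alpha>. \<bar>c \<alpha> * (\<Prod>i\<in>UNIV. (x $ i - a $ i) ^ \<alpha> i)\<bar>) \<le> t * G"
    if t: "t \<in> {0..1}" and x: "\<forall>i. \<bar>x $ i - a $ i\<bar> \<le> t * \<rho>" for x t
  proof -
    have "t * \<rho> \<le> \<rho>" using t \<rho> by simp
    then have "x \<in> ball a r" by (intro in_ball order_trans[OF x[rule_format]])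
    then show ?thesis using c[of x] bound[of t x] t x unfolding M_def by simp
  qed
  note main = this
  have G: "G \<ge> 0" unfolding G_def by (rule infsum_nonneg) simp
  show ?thesis
    by (rule exI[of _ \<rho>], rule conjI[OF \<rho>], rule exI[of _ G], rule conjI[OF G], rule exI[of _ c])
      (intro ballI allI impI main, auto)
qed

text \<open>The majorant with \<open>t = norm (x - a) / \<rho>\<close> gives a Lipschitz estimate at
  \<open>a\<close>.\<close>

lemma isCont_real_analytic_at:
  fixes f :: "real ^ 'd \<Rightarrow> real"
  assumes "real_analytic_at f a"
  shows "isCont f a"
proof -
  obtain \<rho> G c where \<rho>: "\<rho> > 0" and G: "G \<ge> 0"
    and maj: "\<forall>t\<in>{0..1}. \<forall>x. (\<forall>i. \<bar>x $ i - a $ i\<bar> \<le> t * \<rho>) \<longrightarrow>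
       ((\<lambda>\<alpha>. c \<alpha> * (\<Prod>i\<in>UNIV. (x $ i - a $ i) ^ \<alpha> i)) has_sum (f x - f a)) UNIV \<and>
       (\<Sum>\<^sub>\<infinity>\<alpha>. \<bar>c \<alpha> * (\<Prod>i\<in>UNIV. (x $ i - a $ i) ^ \<alpha> i)\<bar>) \<le> t * G"
    using real_analytic_at_majorant[OF assms] by (elim exE conjE) (rule that)
  have lipschitz: "\<bar>f x - f a\<bar> \<le> norm (x - a) / \<rho> * G" if "norm (x - a) < \<rho>" for x
  proof -
    let ?u = "\<lambda>\<alpha>. c \<alpha> * (\<Prod>i\<in>UNIV. (x $ i - a $ i) ^ \<alpha> i)"
    have "\<bar>x $ i - a $ i\<bar> \<le> norm (x - a) / \<rho> * \<rho>" for i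
      using component_le_norm_cart[of "x - a" i] \<rho> by simp
    then have s: "(?u has_sum (f x - f a)) UNIV" and b: "(\<Sum>\<^sub>\<infinity>\<alpha>. \<bar>?u \<alpha>\<bar>) \<le> norm (x - a) / \<rho> * G"
      using maj[rule_format, of "norm (x - a) / \<rho>" x] \<rho> that by (auto simp: divide_le_eq_1)
    have "(\<lambda>\<alpha>. \<bar>?u \<alpha>\<bar>) summable_on UNIV"
      by (rule has_sum_imp_abs_summable_on[OF s])
    then have "\<bar>f x - f a\<bar> \<le> (\<Sum>\<^sub>\<infinity>\<alpha>. \<bar>?u \<alpha>\<bar>)"
      using norm_infsum_bound[of ?u UNIV] infsumI[OF s] by simp
    with b show ?thesis by simp
  qed
  have "((\<lambda>x. norm (x - a) / \<rho> * G) \<longlongrightarrow> norm (a - a) / \<rho> * G) (at a)"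
    by (intro tendsto_intros) (use \<rho> in simp)
  then have lim: "((\<lambda>x. norm (x - a) / \<rho> * G) \<longlongrightarrow> 0) (at a)" by simp
  have "eventually (\<lambda>x. norm (f x - f a) \<le> norm (x - a) / \<rho> * G) (at a)"
    unfolding eventually_at using \<rho> lipschitz by (auto simp: dist_norm intro!: exI[of _ \<rho>])
  then have "((\<lambda>x. f x - f a) \<longlongrightarrow> 0) (at a)"
    by (rule Lim_null_comparison[OF _ lim])
  then show ?thesis
    unfolding isCont_def by (rule iffD2[OF Lim_null])
qed

text \<open>The powers of the inner series are expanded over lists of multi-indices, so that the Cauchy
  products are postponed to a single regrouping of an absolutely convergent sum.\<close>

lemma real_analytic_at_compose:
  fixes f :: "real ^ 'd \<Rightarrow> real"
  assumes f: "real_analytic_at f a" and R: "R > 0"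
    and F: "\<And>t. \<bar>t\<bar> < R \<Longrightarrow> (\<lambda>n. k n * t ^ n) sums F (f a + t)"
  shows "real_analytic_at (\<lambda>x. F (f x)) a"
proof -
  define M where "M x \<alpha> = (\<Prod>i\<in>UNIV. (x $ i - a $ i) ^ \<alpha> i)" for x and \<alpha> :: "'d \<Rightarrow> nat"
  obtain \<rho> G c where \<rho>: "\<rho> > 0" and G: "G \<ge> 0"
    and maj: "\<forall>t\<in>{0..1}. \<forall>x. (\<forall>i. \<bar>x $ i - a $ i\<bar> \<le> t * \<rho>) \<longrightarrow>
       ((\<lambda>\<alpha>. c \<alpha> * M x \<alpha>) has_sum (f x - f a)) UNIV \<and> (\<Sum>\<^sub>\<infinity>\<alpha>. \<bar>c \<alpha> * M x \<alpha>\<bar>) \<le> t * G"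
    using real_analytic_at_majorant[OF f, folded M_def] by (elim exE conjE) (rule that)
  \<comment> \<open>This choice keeps the absolute sum of the inner series below \<open>R\<close>;
    \<open>G + 1\<close> is a positive denominator even if \<open>G = 0\<close>.\<close>
  define t where "t = min 1 (R / (2 * (G + 1)))"
  have t: "t > 0" "t \<le> 1" using R G by (auto simp: t_def)
  have "t * G \<le> R / (2 * (G + 1)) * (G + 1)"
    using t R G by (intro mult_mono) (auto simp: t_def)
  also have "\<dots> < R" using R G by (simp add: field_simps add_pos_nonneg)
  finally have tG: "t * G < R" .
  \<comment> \<open>\<open>\<sigma> L\<close> is the exponent of the product of the monomials listed
    in \<open>L\<close>, and \<open>e L\<close> is the coefficient that comes with it.\<close>
  define \<sigma> where "\<sigma> L = (\<lambda>i. \<Sum>\<alpha>\<leftarrow>L. \<alpha> i)" for L :: "('d \<Rightarrow> nat) list"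
  define e where "e L = k (length L) * prod_list (map c L)" for L
  have expand: "k (length L) * prod_list (map (\<lambda>\<alpha>. c \<alpha> * M x \<alpha>) L) = e L * M x (\<sigma> L)" for L x
  proof -
    have "prod_list (map (\<lambda>\<alpha>. c \<alpha> * M x \<alpha>) L) = prod_list (map c L) * M x (\<sigma> L)"
      by (induction L) (auto simp: M_def \<sigma>_def power_add prod.distrib)
    then show ?thesis by (simp add: e_def)
  qed
  \<comment> \<open>An infinite sum, since inserting zero multi-indices into a list does not change
    \<open>\<sigma>\<close>.\<close>
  define q where "q \<gamma> = (\<Sum>\<^sub>\<infinity>L\<in>{L. \<sigma> L = \<gamma>}. e L)" for \<gamma>
  have "((\<lambda>\<gamma>. q \<gamma> * M x \<gamma>) has_sum F (f x)) UNIV" if x: "x \<in> ball a (t * \<rho>)" for x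
  proof -
    define u where "u = (\<lambda>\<alpha>. c \<alpha> * M x \<alpha>)"
    define s where "s = (\<Sum>\<^sub>\<infinity>\<alpha>. \<bar>u \<alpha>\<bar>)"
    have "\<bar>x $ i - a $ i\<bar> \<le> t * \<rho>" for i
      using component_le_norm_cart[of "x - a" i] x by (simp add: dist_norm norm_minus_commute)
    then have u: "(u has_sum (f x - f a)) UNIV" and s: "s < R"
      using maj[rule_format, of t x] t tG by (auto simp: u_def s_def)
    have "(\<lambda>\<alpha>. \<bar>u \<alpha>\<bar>) summable_on UNIV"
      by (rule has_sum_imp_abs_summable_on[OF u])
    then have us: "((\<lambda>\<alpha>. \<bar>u \<alpha>\<bar>) has_sum s) UNIV" and fs: "\<bar>f x - f a\<bar> \<le> s"
      using norm_infsum_bound[of u UNIV] infsumI[OF u] by (auto simp: s_def)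
    have s0: "0 \<le> s" unfolding s_def by (rule infsum_nonneg) simp
    \<comment> \<open>Convergence at a point strictly beyond \<open>s\<close> yields absolute
      convergence for all \<open>\<bar>z\<bar> \<le> s\<close>.\<close>
    obtain s' where s': "s < s'" "s' < R" using s dense by blast
    have "summable (\<lambda>n. k n * s' ^ n)" using F[of s'] s' s0 by (auto dest: sums_summable)
    then have "summable (\<lambda>n. norm (k n * z ^ n))" if "\<bar>z\<bar> \<le> s" for z
      by (rule powser_insidea) (use s' s0 that in auto)
    note sumk = this
    have abs_k: "(\<lambda>n. \<bar>k n\<bar> * s ^ n) summable_on UNIV"
      using sumk[of s] s0 by (intro norm_summable_imp_summable_on) (simp add: abs_mult power_abs)
    have Fx: "((\<lambda>n. k n * (f x - f a) ^ n) has_sum F (f x)) UNIV"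
      using F[of "f x - f a"] fs s by (intro norm_summable_imp_has_sum sumk) auto
    \<comment> \<open>On words of length \<open>n\<close> the absolute products sum to
      \<open>s ^ n\<close>, so \<open>abs_k\<close> controls the double sum and the terms may be
      regrouped.\<close>
    have "(\<lambda>p. \<bar>k (fst p) * prod_list (map u (snd p))\<bar>) summable_on (SIGMA n:UNIV. {L. length L = n})"
    proof (rule summable_on_SigmaI[OF _ abs_k])
      fix n
      have "prod_list (map (\<lambda>\<alpha>. \<bar>u \<alpha>\<bar>) L) = \<bar>prod_list (map u L)\<bar>" for L
        by (induction L) (auto simp: abs_mult)
      with has_sum_cmult_right[OF has_sum_prod_list_power[OF us], of "\<bar>k n\<bar>" n]
      show "((\<lambda>L. \<bar>k (fst (n, L)) * prod_list (map u (snd (n, L)))\<bar>) has_sum \<bar>k n\<bar> * s ^ n) {L. length L = n}"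
        by (simp add: abs_mult)
    qed auto
    then have "(\<lambda>p. k (fst p) * prod_list (map u (snd p))) summable_on (SIGMA n:UNIV. {L. length L = n})"
      by (rule abs_summable_on_imp_summable_on)
    with Fx have "((\<lambda>p. k (fst p) * prod_list (map u (snd p))) has_sum F (f x)) (SIGMA n:UNIV. {L. length L = n})"
      by (intro has_sum_SigmaI[where g = "\<lambda>n. k n * (f x - f a) ^ n"])
        (auto intro!: has_sum_cmult_right has_sum_prod_list_power u)
    \<comment> \<open>The same words are now sorted by total exponent instead of by length.\<close>
    also have "?this \<longleftrightarrow> ((\<lambda>(\<gamma>, L). e L * M x \<gamma>) has_sum F (f x)) (SIGMA \<gamma>:UNIV. {L. \<sigma> L = \<gamma>})"
      by (rule has_sum_reindex_bij_witness[
            where i = "\<lambda>p. (length (snd p), snd p)" and j = "\<lambda>p. (\<sigma> (snd p), snd p)"])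
        (auto simp: u_def expand)
    finally have S: "((\<lambda>(\<gamma>, L). e L * M x \<gamma>) has_sum F (f x)) (SIGMA \<gamma>:UNIV. {L. \<sigma> L = \<gamma>})" .
    have "((\<lambda>\<gamma>. \<Sum>\<^sub>\<infinity>L\<in>{L. \<sigma> L = \<gamma>}. e L * M x \<gamma>) has_sum F (f x)) UNIV"
      by (rule has_sum_SigmaD[OF S])
        (use summable_on_SigmaD1[OF has_sum_imp_summable[OF S]] in
          \<open>auto intro!: has_sum_infsum\<close>)
    \<comment> \<open>Pulling out \<open>M x \<gamma>\<close> is valid even where it vanishes, when
      both sides are 0 whether or not \<open>e\<close> is summable on the fibre.\<close>
    then show ?thesis by (simp add: q_def infsum_cmult_left')
  qed
  then show ?thesis
    unfolding real_analytic_at_def M_def using t \<rho> by (intro exI[of _ q] exI[of _ "t * \<rho>"]) auto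
qed

section \<open>Sums, inverses and exponentials of analytic functions\<close>

lemma real_analytic_at_sum:
  assumes "\<And>j. j \<in> J \<Longrightarrow> real_analytic_at (f j) a"
  shows "real_analytic_at (\<lambda>x. \<Sum>j\<in>J. f j x) a"
  using assms
  by (induction J rule: infinite_finite_induct)
    (auto intro: real_analytic_at_const real_analytic_at_add)

lemma real_analytic_at_diff:
  assumes "real_analytic_at f a" "real_analytic_at g a"
  shows "real_analytic_at (\<lambda>x. f x - g x) a"
  using real_analytic_at_add[OF assms(1) real_analytic_at_mult[OF real_analytic_at_const[of "-1"] assms(2)]]
  by simp

text \<open>Around \<open>f a\<close> the reciprocal is a geometric series in
  \<open>- t / f a\<close>, convergent for \<open>\<bar>t\<bar> < \<bar>f a\<bar>\<close>.\<close>

lemma real_analytic_at_inverse: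
  assumes "real_analytic_at f a" and nz: "f a \<noteq> 0"
  shows "real_analytic_at (\<lambda>x. inverse (f x)) a"
proof (rule real_analytic_at_compose[OF assms(1)])
  show "\<bar>f a\<bar> > 0" using nz by simp
  show "(\<lambda>n. (inverse (f a) * (- inverse (f a)) ^ n) * t ^ n) sums inverse (f a + t)"
    if t: "\<bar>t\<bar> < \<bar>f a\<bar>" for t
  proof -
    have "f a + t \<noteq> 0" using t by auto
    have "norm (- inverse (f a) * t) < 1" using t nz by (simp add: abs_mult field_simps)
    from sums_mult[OF geometric_sums[OF this], of "inverse (f a)"]
    have "(\<lambda>n. inverse (f a) * (- inverse (f a) * t) ^ n) sums
        (inverse (f a) * (1 / (1 - (- inverse (f a) * t))))" .
    also have "inverse (f a) * (1 / (1 - (- inverse (f a) * t))) = inverse (f a + t)"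
      using nz \<open>f a + t \<noteq> 0\<close> by (simp add: field_simps)
    also have "(\<lambda>n. inverse (f a) * (- inverse (f a) * t) ^ n)
        = (\<lambda>n. (inverse (f a) * (- inverse (f a)) ^ n) * t ^ n)"
      by (simp only: power_mult_distrib mult.assoc)
    finally show ?thesis .
  qed
qed

lemma real_analytic_at_exp:
  assumes "real_analytic_at f a"
  shows "real_analytic_at (\<lambda>x. exp (f x)) a"
proof (rule real_analytic_at_compose[OF assms])
  show "(\<lambda>n. (exp (f a) / fact n) * t ^ n) sums exp (f a + t)" if "\<bar>t\<bar> < 1" for t
    using sums_mult[OF exp_converges[of t], of "exp (f a)"] by (simp add: exp_add field_simps)
qed simp

text \<open>The function \<open>\<phi>\<close> of the overview; the value 1 at 0 fills the removable
  singularity, so that it is analytic and has no zero.\<close>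

definition exp_quot :: "real \<Rightarrow> real" where
  "exp_quot t = (if t = 0 then 1 else (exp t - 1) / t)"

lemma exp_quot_mult: "exp_quot t * t = exp t - 1"
  by (simp add: exp_quot_def)

lemma exp_quot_nonzero: "exp_quot t \<noteq> 0"
  by (simp add: exp_quot_def)

text \<open>Dropping the constant term of the exponential series and dividing by \<open>t\<close>
  leaves the coefficients \<open>1 / fact (Suc n)\<close>; \<open>f a = 0\<close> places the centre
  of this expansion at 0.\<close>

lemma real_analytic_at_exp_quot:
  assumes "real_analytic_at f a" "f a = 0"
  shows "real_analytic_at (\<lambda>x. exp_quot (f x)) a"
proof (rule real_analytic_at_compose[OF assms(1)])
  show "(\<lambda>n. inverse (fact (Suc n)) * t ^ n) sums exp_quot (f a + t)" if "\<bar>t\<bar> < 1" for t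
  proof (cases "t = 0")
    case True
    then show ?thesis
      using powser_sums_zero[of "\<lambda>n. inverse (fact (Suc n))"] assms(2) by (simp add: exp_quot_def)
  next
    case False
    have "(\<lambda>n. t ^ Suc n /\<^sub>R fact (Suc n)) sums (exp t - 1)"
      using exp_converges[of t] sums_Suc_iff[of "\<lambda>n. t ^ n /\<^sub>R fact n" "exp t - 1"] by simp
    from sums_divide[OF this, of t] show ?thesis
      using False assms(2) by (simp add: exp_quot_def mult.assoc)
  qed
qed simp

subsection \<open>Thresholds of comparable functions\<close>

text \<open>For \<open>c \<ge> 0\<close> the estimate comes from the bound on \<open>t\<close> by
  \<open>s\<close>, for \<open>c < 0\<close> from the bound on \<open>s\<close> by \<open>t\<close>;
  the exponent \<open>\<bar>c\<bar>\<close> covers both signs.\<close>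

lemma abs_neg_power_le:
  assumes "M > 0" "\<bar>s\<bar> \<le> M * \<bar>t\<bar>" "\<bar>t\<bar> \<le> M * \<bar>s\<bar>"
  shows "abs_neg_power c s \<le> ennreal (M powr \<bar>c\<bar>) * abs_neg_power c t"
proof (cases "s = 0 \<or> t = 0")
  \<comment> \<open>Two-sided comparability forces common zeros, so both sides involve the same
    conventional value at 0, and a positive factor preserves \<open>\<infinity>\<close>.\<close>
  case True
  then have "s = 0" "t = 0" using assms by auto
  then show ?thesis using assms(1) by (auto simp: abs_neg_power_def ennreal_mult_top)
next
  case False
  have "\<bar>s\<bar> powr (- c) \<le> M powr \<bar>c\<bar> * \<bar>t\<bar> powr (- c)"
  proof (cases "c \<ge> 0")
    case True
    have "\<bar>t\<bar> powr c \<le> (M * \<bar>s\<bar>) powr c" by (rule powr_mono2) (use True assms in auto)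
    then show ?thesis using False True assms by (simp add: powr_minus powr_mult field_simps)
  next
    case c: False
    have "\<bar>s\<bar> powr (- c) \<le> (M * \<bar>t\<bar>) powr (- c)" by (rule powr_mono2) (use c assms in auto)
    then show ?thesis using c assms by (simp add: powr_mult)
  qed
  then show ?thesis using False by (simp add: abs_neg_power_def flip: ennreal_mult')
qed

lemma locally_L1_on_comparable:
  fixes f g :: "real ^ 'd \<Rightarrow> real"
  assumes cont: "continuous_on V f" and M: "M > 0"
    and fg: "\<And>w. w \<in> V \<Longrightarrow> \<bar>f w\<bar> \<le> M * \<bar>g w\<bar>" "\<And>w. w \<in> V \<Longrightarrow> \<bar>g w\<bar> \<le> M * \<bar>f w\<bar>"
    and g: "locally_L1_on U (\<lambda>w. abs_neg_power c (g w))"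
  shows "locally_L1_on (U \<inter> V) (\<lambda>w. abs_neg_power c (f w))"
  unfolding locally_L1_on_def
proof (intro allI impI conjI)
  fix K assume K: "compact K \<and> K \<subseteq> U \<inter> V"
  have Kb: "K \<in> sets borel" using K by (simp add: borel_closed compact_imp_closed)
  \<comment> \<open>Continuity is known only on \<open>V\<close>, so \<open>f\<close> is cut off to
    \<open>K\<close> before composing; the outer indicator removes the values that the cut-off
    creates outside \<open>K\<close>.\<close>
  have "(\<lambda>w. indicator K w *\<^sub>R f w) \<in> borel_measurable borel"
    by (rule borel_measurable_continuous_on_indicator[OF Kb])
      (use K cont continuous_on_subset in blast)
  moreover have "abs_neg_power c \<in> borel_measurable borel"
    unfolding abs_neg_power_def by measurable
  ultimately have "(\<lambda>w. abs_neg_power c (indicator K w *\<^sub>R f w) * indicator K w) \<in> borel_measurable borel"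
    using Kb by measurable
  also have "(\<lambda>w. abs_neg_power c (indicator K w *\<^sub>R f w) * indicator K w)
      = (\<lambda>w. abs_neg_power c (f w) * indicator K w)"
    by (auto simp: fun_eq_iff indicator_def)
  finally show "(\<lambda>w. abs_neg_power c (f w) * indicator K w) \<in> borel_measurable lebesgue"
    by (intro measurable_completion) simp
  have gK: "(\<lambda>w. abs_neg_power c (g w) * indicator K w) \<in> borel_measurable lebesgue"
    "(\<integral>\<^sup>+ w. abs_neg_power c (g w) * indicator K w \<partial>lebesgue) < \<infinity>"
    using g K unfolding locally_L1_on_def by auto
  have "(\<integral>\<^sup>+ w. abs_neg_power c (f w) * indicator K w \<partial>lebesgue)
      \<le> (\<integral>\<^sup>+ w. ennreal (M powr \<bar>c\<bar>) * (abs_neg_power c (g w) * indicator K w) \<partial>lebesgue)"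
    using K abs_neg_power_le[OF M fg] by (intro nn_integral_mono) (auto simp: indicator_def)
  also have "\<dots> = ennreal (M powr \<bar>c\<bar>) * (\<integral>\<^sup>+ w. abs_neg_power c (g w) * indicator K w \<partial>lebesgue)"
    by (rule nn_integral_cmult[OF gK(1)])
  also have "\<dots> < \<infinity>" using gK(2) by (simp add: ennreal_mult_less_top)
  finally show "(\<integral>\<^sup>+ w. abs_neg_power c (f w) * indicator K w \<partial>lebesgue) < \<infinity>" .
qed

text \<open>Intersecting a witness neighbourhood with \<open>V\<close> transfers local integrability
  in both directions, so the two suprema range over the same exponents.\<close>

lemma lct_eq_of_comparable:
  fixes f g :: "real ^ 'd \<Rightarrow> real"
  assumes V: "open V" "w0 \<in> V" and cont: "continuous_on V f" "continuous_on V g" and M: "M > 0"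
    and fg: "\<And>w. w \<in> V \<Longrightarrow> \<bar>f w\<bar> \<le> M * \<bar>g w\<bar>" "\<And>w. w \<in> V \<Longrightarrow> \<bar>g w\<bar> \<le> M * \<bar>f w\<bar>"
  shows "lct w0 f = lct w0 g"
proof -
  have "(\<exists>U. open U \<and> w0 \<in> U \<and> locally_L1_on U (\<lambda>w. abs_neg_power c (f w)))
    \<longleftrightarrow> (\<exists>U. open U \<and> w0 \<in> U \<and> locally_L1_on U (\<lambda>w. abs_neg_power c (g w)))" for c
    using locally_L1_on_comparable[OF cont(1) M fg, of _ c]
      locally_L1_on_comparable[OF cont(2) M fg(2) fg(1), of _ c] V
    by (meson IntI open_Int)
  then show ?thesis unfolding lct_def by simp
qed

subsection \<open>Analytic linear combinations\<close>

lemma germ_sum_mem_ideal: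
  fixes q F :: "'i \<Rightarrow> real ^ 'd \<Rightarrow> real"
  assumes I: "ideal I (analytic_germs a)"
    and "\<And>j. j \<in> J \<Longrightarrow> real_analytic_at (q j) a" "\<And>j. j \<in> J \<Longrightarrow> germ a (F j) \<in> I"
  shows "germ a (\<lambda>w. \<Sum>j\<in>J. q j w * F j w) \<in> I"
proof -
  interpret ideal I "analytic_germs a" by (rule I)
  show ?thesis
  using assms(2,3) proof (induction J rule: infinite_finite_induct)
    case (insert j J)
    have "germ a (q j) \<otimes>\<^bsub>analytic_germs a\<^esub> germ a (F j) \<in> I"
      by (rule I_l_closed) (use insert in \<open>auto simp: carrier_analytic_germs\<close>)
    then have "germ a (\<lambda>w. q j w * F j w) \<oplus>\<^bsub>analytic_germs a\<^esub> germ a (\<lambda>w. \<Sum>j\<in>J. q j w * F j w) \<in> I"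
      using insert by (intro additive_subgroup.a_closed[OF is_additive_subgroup]) (auto simp: germ_mult)
    then show ?case using insert(1,2) by (simp add: germ_add)
  \<comment> \<open>An empty or infinite \<open>J\<close> yields the zero germ.\<close>
  qed (use additive_subgroup.zero_closed[OF is_additive_subgroup] in \<open>simp_all add: germ_zero\<close>)
qed

text \<open>By minimality of generated ideals it suffices to place each generator \<open>f i\<close>
  in the larger ideal, which its linear representation does.\<close>

lemma genideal_germ_subset:
  assumes "\<And>i. i \<in> I \<Longrightarrow> f i = (\<lambda>w. \<Sum>j\<in>J. q i j w * F j w)"
    and "\<And>i j. i \<in> I \<Longrightarrow> j \<in> J \<Longrightarrow> real_analytic_at (q i j) a"
    and F: "\<And>j. j \<in> J \<Longrightarrow> real_analytic_at (F j) a"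
  shows "genideal (analytic_germs a) ((\<lambda>i. germ a (f i)) ` I)
    \<subseteq> genideal (analytic_germs a) ((\<lambda>j. germ a (F j)) ` J)"
proof -
  interpret cring "analytic_germs a" by (rule cring_analytic_germs)
  let ?G = "(\<lambda>j. germ a (F j)) ` J"
  have G: "?G \<subseteq> carrier (analytic_germs a)" using F by (auto simp: carrier_analytic_germs)
  show ?thesis
    by (rule genideal_minimal[OF genideal_ideal[OF G]])
      (use assms genideal_self[OF G] in \<open>auto intro!: germ_sum_mem_ideal genideal_ideal[OF G]\<close>)
qed

text \<open>By Cauchy-Schwarz the squared Frobenius norm \<open>Q\<close> of the coefficient matrix
  is an admissible factor, and by continuity it stays below \<open>Q a + 1\<close> near
  \<open>a\<close>.\<close>

lemma eventually_L2_set_le: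
  fixes q :: "'i \<Rightarrow> 'j \<Rightarrow> real ^ 'd \<Rightarrow> real"
  assumes fin: "finite I" "finite J"
    and f: "\<And>i. i \<in> I \<Longrightarrow> f i = (\<lambda>w. \<Sum>j\<in>J. q i j w * F j w)"
    and q: "\<And>i j. i \<in> I \<Longrightarrow> j \<in> J \<Longrightarrow> isCont (q i j) a"
  shows "\<exists>C>0. eventually (\<lambda>w. (L2_set (\<lambda>i. f i w) I)\<^sup>2 \<le> C * (L2_set (\<lambda>j. F j w) J)\<^sup>2) (nhds a)"
proof -
  define Q where "Q w = (\<Sum>i\<in>I. \<Sum>j\<in>J. (q i j w)\<^sup>2)" for w
  have "isCont Q a" unfolding Q_def by (intro continuous_intros q)
  then have "(Q \<longlongrightarrow> Q a) (nhds a)" by (simp add: isCont_def tendsto_nhds_iff)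
  then have ev: "eventually (\<lambda>w. Q w < Q a + 1) (nhds a)"
    by (rule order_tendstoD) simp
  have le: "(L2_set (\<lambda>i. f i w) I)\<^sup>2 \<le> Q w * (L2_set (\<lambda>j. F j w) J)\<^sup>2" for w
  proof -
    have "(L2_set (\<lambda>i. f i w) I)\<^sup>2 = (\<Sum>i\<in>I. (\<Sum>j\<in>J. q i j w * F j w)\<^sup>2)"
      unfolding L2_set_def using f by (simp add: sum_nonneg)
    also have "\<dots> \<le> (\<Sum>i\<in>I. (\<Sum>j\<in>J. (q i j w)\<^sup>2) * (\<Sum>j\<in>J. (F j w)\<^sup>2))"
      by (rule sum_mono) (rule Cauchy_Schwarz_ineq_sum)
    also have "\<dots> = Q w * (L2_set (\<lambda>j. F j w) J)\<^sup>2"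
      by (simp add: Q_def L2_set_def sum_nonneg sum_distrib_right)
    finally show ?thesis .
  qed
  have "Q a \<ge> 0" unfolding Q_def by (intro sum_nonneg) auto
  moreover have "eventually (\<lambda>w. (L2_set (\<lambda>i. f i w) I)\<^sup>2 \<le> (Q a + 1) * (L2_set (\<lambda>j. F j w) J)\<^sup>2) (nhds a)"
    using ev by eventually_elim (rule order_trans[OF le], auto intro!: mult_right_mono)
  ultimately show ?thesis by (intro exI[of _ "Q a + 1"]) auto
qed

subsection \<open>Softmax differences\<close>

lemma sum_softmax:
  assumes "H \<ge> 1"
  shows "(\<Sum>i=1..H. softmax H y i) = 1"
proof -
  have "(\<Sum>j=1..H. exp (y j)) > 0" using assms by (intro sum_pos) auto
  then show ?thesis by (simp add: softmax_def flip: sum_divide_distrib)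
qed

lemma softmax_pos:
  assumes "H \<ge> 1"
  shows "softmax H y i > 0"
proof -
  have "(\<Sum>j=1..H. exp (y j)) > 0" using assms by (intro sum_pos) auto
  then show ?thesis by (simp add: softmax_def)
qed

text \<open>Here \<open>y\<close> and \<open>y0\<close> are the logit vectors at \<open>w\<close>
  and \<open>w0\<close>. The identities are pure algebra at one point, with explicit coefficients
  from which analyticity in \<open>w\<close> can be read off later.\<close>

context
  fixes H :: nat and y y0 z :: "nat \<Rightarrow> real" and S :: real
  assumes H: "H \<ge> 2"
  defines "z \<equiv> \<lambda>i. y i - y 1 - (y0 i - y0 1)"
    and "S \<equiv> \<Sum>j=1..H. softmax H y0 j * exp (z j)"
begin

lemma softmax_normalizer_pos: "S > 0"
  unfolding S_def using H softmax_pos[of H y0] by (intro sum_pos) auto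

lemma softmax_eq_relative: "softmax H y i = softmax H y0 i * exp (z i) * inverse S"
proof -
  \<comment> \<open>The factor by which all terms \<open>softmax H y0 j * exp (z j)\<close> differ
    from \<open>exp (y j)\<close>; it cancels on normalizing.\<close>
  define K where "K = exp (y0 1 - y 1) / (\<Sum>j=1..H. exp (y0 j))"
  have "(\<Sum>j=1..H. exp (y0 j)) > 0" using H by (intro sum_pos) auto
  then have K: "K > 0" by (simp add: K_def)
  have eq: "softmax H y0 j * exp (z j) = K * exp (y j)" for j
    by (simp add: softmax_def z_def K_def exp_diff exp_add field_simps)
  have S: "S = K * (\<Sum>j=1..H. exp (y j))"
    unfolding S_def eq by (simp add: sum_distrib_left)
  show ?thesis unfolding eq S using K by (simp add: softmax_def divide_simps)
qed

lemma softmax_diff_eq_sum: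
  assumes i: "i \<in> {1..H}"
  shows "softmax H y i - softmax H y0 i =
    (\<Sum>j=2..H. (softmax H y0 i * inverse S * (of_bool (j = i) - softmax H y0 j) * exp_quot (z j)) * z j)"
proof -
  let ?p = "softmax H y0"
  have split: "sum f {1..H} = f 1 + sum f {2..H}" for f :: "nat \<Rightarrow> real"
    using sum.atLeast_Suc_atMost[of 1 H f] H by (simp add: numeral_2_eq_2)
  have z1: "z 1 = 0" by (simp add: z_def)
  \<comment> \<open>Since the \<open>?p j\<close> sum to 1, subtracting 1 from \<open>S\<close>
    amounts to subtracting 1 from each exponential.\<close>
  have "exp (z i) - S = (exp (z i) - 1) - (\<Sum>j=1..H. ?p j * (exp (z j) - 1))"
    using H sum_softmax[of H y0] by (simp add: S_def right_diff_distrib sum_subtractf)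
  also have "exp (z i) - 1 = (\<Sum>j=1..H. of_bool (j = i) * (exp (z j) - 1))"
    using i by (simp add: of_bool_def if_distrib[of "\<lambda>c. c * _"] cong: if_cong)
  also have "\<dots> - (\<Sum>j=1..H. ?p j * (exp (z j) - 1)) = (\<Sum>j=1..H. (of_bool (j = i) - ?p j) * (exp (z j) - 1))"
    by (simp add: left_diff_distrib sum_subtractf)
  \<comment> \<open>The term for index 1 drops out because \<open>z 1 = 0\<close>.\<close>
  also have "\<dots> = (\<Sum>j=2..H. (of_bool (j = i) - ?p j) * (exp (z j) - 1))"
    using z1 by (subst split) simp
  finally have e: "exp (z i) - S = (\<Sum>j=2..H. (of_bool (j = i) - ?p j) * (exp_quot (z j) * z j))"
    by (simp add: exp_quot_mult)
  have "softmax H y i - ?p i = ?p i * inverse S * (exp (z i) - S)"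
    using softmax_normalizer_pos by (simp add: softmax_eq_relative field_simps)
  then show ?thesis unfolding e by (simp add: sum_distrib_left mult.assoc)
qed

text \<open>Dividing component \<open>i\<close> by component 1 cancels \<open>S\<close> and recovers
  \<open>exp (z i)\<close>. Only \<open>j = i\<close> and \<open>j = 1\<close> carry nonzero
  coefficients, and dividing by \<open>exp_quot (z i)\<close> turns \<open>exp (z i) - 1\<close>
  into \<open>z i\<close>.\<close>

lemma logit_diff_eq_sum:
  assumes i: "i \<in> {2..H}"
  shows "z i = (\<Sum>j=1..H.
      ((of_bool (j = i) * softmax H y0 1 * inverse (softmax H y0 i) - of_bool (j = 1))
        * (inverse (softmax H y 1) * inverse (exp_quot (z i)))) * (softmax H y j - softmax H y0 j))"
proof -
  let ?p = "softmax H y0" and ?s = "softmax H y"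
  define c where "c = inverse (?s 1) * inverse (exp_quot (z i))"
  have pos: "?p i > 0" "?p 1 > 0" "?s 1 > 0" using H by (auto intro: softmax_pos)
  have "(\<Sum>j=1..H. ((of_bool (j = i) * ?p 1 * inverse (?p i) - of_bool (j = 1)) * c) * (?s j - ?p j))
      = (\<Sum>j=1..H. of_bool (j = i) * (?p 1 * inverse (?p i) * c * (?s j - ?p j)))
        - (\<Sum>j=1..H. of_bool (j = 1) * (c * (?s j - ?p j)))"
    by (simp add: algebra_simps flip: sum_subtractf)
  also have "\<dots> = ?p 1 * inverse (?p i) * c * (?s i - ?p i) - c * (?s 1 - ?p 1)"
    using i by (simp add: of_bool_def if_distrib[of "\<lambda>c. c * _"] cong: if_cong)
  \<comment> \<open>The constants \<open>- ?p 1\<close> and \<open>+ ?p 1\<close> from the two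
    differences cancel.\<close>
  also have "\<dots> = (?s i * ?p 1 / (?p i * ?s 1) - 1) * inverse (exp_quot (z i))"
    unfolding c_def using pos exp_quot_nonzero[of "z i"] by (simp add: field_simps)
  also have "?s i * ?p 1 / (?p i * ?s 1) = exp (z i)"
    unfolding softmax_eq_relative using pos softmax_normalizer_pos by (simp add: z_def)
  also have "(exp (z i) - 1) * inverse (exp_quot (z i)) = z i"
    using exp_quot_nonzero[of "z i"] by (simp flip: exp_quot_mult)
  finally show ?thesis by (simp add: c_def)
qed

end

section \<open>Equality of the ideals and of the thresholds\<close>

theorem theorem7:
  fixes H :: nat and W :: "(real ^ 'd) set" and w0 :: "real ^ 'd"
    and x :: 'x and h :: "nat \<Rightarrow> 'x \<Rightarrow> real ^ 'd \<Rightarrow> real"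
  assumes "H \<ge> 2" and "open W" and "w0 \<in> W"
    and "\<And>i. i \<in> {1..H} \<Longrightarrow> real_analytic_on (\<lambda>w. h i x w) W"
  shows "genideal (analytic_germs w0)
           ((\<lambda>i. germ w0 (\<lambda>w. softmax H (\<lambda>j. h j x w) i - softmax H (\<lambda>j. h j x w0) i)) ` {1..H})
         = genideal (analytic_germs w0)
           ((\<lambda>i. germ w0 (\<lambda>w. h i x w - h 1 x w - (h i x w0 - h 1 x w0))) ` {2..H})
       \<and> lct w0 (\<lambda>w. (L2_set (\<lambda>i. softmax H (\<lambda>j. h j x w) i - softmax H (\<lambda>j. h j x w0) i) {1..H})\<^sup>2)
         = lct w0 (\<lambda>w. (L2_set (\<lambda>i. (h i x w - h 1 x w) - (h i x w0 - h 1 x w0)) {2..H})\<^sup>2)"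
proof -
  note H = assms(1)
  define p where "p = softmax H (\<lambda>j. h j x w0)"
  define s where "s i w = softmax H (\<lambda>j. h j x w) i" for i w
  define z where "z i w = h i x w - h 1 x w - (h i x w0 - h 1 x w0)" for i w
  define S where "S w = (\<Sum>j=1..H. p j * exp (z j w))" for w
  define f where "f i w = s i w - p i" for i w
  \<comment> \<open>\<open>q\<close> expresses each \<open>f i\<close> through the
    \<open>z j\<close>, and \<open>r\<close> each \<open>z i\<close> through the \<open>f j\<close>.
    Their entries are analytic at \<open>w0\<close> because every inverted function is nonzero
    there.\<close>
  define q where "q i j w = p i * inverse (S w) * (of_bool (j = i) - p j) * exp_quot (z j w)" for i j w
  define r where "r i j w = (of_bool (j = i) * p 1 * inverse (p i) - of_bool (j = 1))
      * (inverse (s 1 w) * inverse (exp_quot (z i w)))" for i j w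
  have han: "real_analytic_at (\<lambda>w. h i x w) w" if "i \<in> {1..H}" "w \<in> W" for i w
    using assms(4) that unfolding real_analytic_on_def by blast
  have zan: "real_analytic_at (z i) w0" if "i \<in> {1..H}" for i
    unfolding z_def using that H assms(3)
    by (intro real_analytic_at_diff real_analytic_at_const han) auto
  have z0: "z i w0 = 0" for i by (simp add: z_def)
  have ppos: "p i > 0" for i using H by (simp add: p_def softmax_pos)
  have Spos: "S w > 0" for w unfolding S_def using H ppos by (intro sum_pos) auto
  have Sinv: "real_analytic_at (\<lambda>w. inverse (S w)) w0"
    unfolding S_def using Spos[of w0, unfolded S_def]
    by (intro real_analytic_at_inverse real_analytic_at_sum real_analytic_at_mult
        real_analytic_at_const real_analytic_at_exp zan) auto
  \<comment> \<open>In this form the analyticity and continuity of \<open>s\<close> are inherited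
    from the \<open>z j\<close>.\<close>
  have s_eq: "s i w = p i * exp (z i w) * inverse (S w)" for i w
    unfolding s_def p_def z_def S_def by (rule softmax_eq_relative[OF H])
  have san: "real_analytic_at (s i) w0" if "i \<in> {1..H}" for i
    unfolding s_eq[abs_def]
    by (intro real_analytic_at_mult real_analytic_at_const real_analytic_at_exp zan Sinv that)
  have spos: "s i w > 0" for i w using H by (simp add: s_def softmax_pos)
  have eq_an: "real_analytic_at (\<lambda>w. exp_quot (z i w)) w0" if "i \<in> {1..H}" for i
    by (rule real_analytic_at_exp_quot[OF zan[OF that] z0])
  have qan: "real_analytic_at (q i j) w0" if "i \<in> {1..H}" "j \<in> {2..H}" for i j
    unfolding q_def using that
    by (intro real_analytic_at_mult real_analytic_at_const Sinv eq_an) auto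
  have ran: "real_analytic_at (r i j) w0" if "i \<in> {2..H}" "j \<in> {1..H}" for i j
    unfolding r_def using that H spos[of 1 w0]
    by (intro real_analytic_at_mult real_analytic_at_const real_analytic_at_inverse san eq_an)
      (auto simp: exp_quot_nonzero)
  have fan: "real_analytic_at (f i) w0" if "i \<in> {1..H}" for i
    unfolding f_def by (intro real_analytic_at_diff real_analytic_at_const san that)
  have f_eq: "f i = (\<lambda>w. \<Sum>j=2..H. q i j w * z j w)" if "i \<in> {1..H}" for i
    unfolding f_def s_def q_def p_def z_def S_def by (rule ext, rule softmax_diff_eq_sum[OF H that])
  have z_eq: "z i = (\<lambda>w. \<Sum>j=1..H. r i j w * f j w)" if "i \<in> {2..H}" for i
    unfolding f_def s_def r_def p_def z_def by (rule ext, rule logit_diff_eq_sum[OF H that])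

  have "genideal (analytic_germs w0) ((\<lambda>i. germ w0 (f i)) ` {1..H})
      = genideal (analytic_germs w0) ((\<lambda>i. germ w0 (z i)) ` {2..H})"
  proof (rule antisym)
    show "genideal (analytic_germs w0) ((\<lambda>i. germ w0 (f i)) ` {1..H})
      \<subseteq> genideal (analytic_germs w0) ((\<lambda>i. germ w0 (z i)) ` {2..H})"
      by (rule genideal_germ_subset[OF f_eq qan zan]) auto
    show "genideal (analytic_germs w0) ((\<lambda>i. germ w0 (z i)) ` {2..H})
      \<subseteq> genideal (analytic_germs w0) ((\<lambda>i. germ w0 (f i)) ` {1..H})"
      by (rule genideal_germ_subset[OF z_eq ran fan])
  qed
  moreover have "lct w0 (\<lambda>w. (L2_set (\<lambda>i. f i w) {1..H})\<^sup>2) = lct w0 (\<lambda>w. (L2_set (\<lambda>i. z i w) {2..H})\<^sup>2)"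
  proof -
    have "\<exists>C>0. eventually (\<lambda>w. (L2_set (\<lambda>i. f i w) {1..H})\<^sup>2 \<le> C * (L2_set (\<lambda>i. z i w) {2..H})\<^sup>2) (nhds w0)"
      by (rule eventually_L2_set_le[OF _ _ f_eq isCont_real_analytic_at[OF qan]]) simp_all
    then obtain C where C: "C > 0"
      "eventually (\<lambda>w. (L2_set (\<lambda>i. f i w) {1..H})\<^sup>2 \<le> C * (L2_set (\<lambda>i. z i w) {2..H})\<^sup>2) (nhds w0)"
      by (elim exE conjE) (rule that)
    have "\<exists>D>0. eventually (\<lambda>w. (L2_set (\<lambda>i. z i w) {2..H})\<^sup>2 \<le> D * (L2_set (\<lambda>i. f i w) {1..H})\<^sup>2) (nhds w0)"
      by (rule eventually_L2_set_le[OF _ _ z_eq isCont_real_analytic_at[OF ran]]) simp_all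
    then obtain D where D: "D > 0"
      "eventually (\<lambda>w. (L2_set (\<lambda>i. z i w) {2..H})\<^sup>2 \<le> D * (L2_set (\<lambda>i. f i w) {1..H})\<^sup>2) (nhds w0)"
      by (elim exE conjE) (rule that)
    obtain V where V: "open V" "w0 \<in> V"
      "\<And>w. w \<in> V \<Longrightarrow> (L2_set (\<lambda>i. f i w) {1..H})\<^sup>2 \<le> C * (L2_set (\<lambda>i. z i w) {2..H})\<^sup>2"
      "\<And>w. w \<in> V \<Longrightarrow> (L2_set (\<lambda>i. z i w) {2..H})\<^sup>2 \<le> D * (L2_set (\<lambda>i. f i w) {1..H})\<^sup>2"
      using eventually_conj[OF C(2) D(2)] unfolding eventually_nhds by blast
    \<comment> \<open>Measurability near \<open>w0\<close> calls for continuity on a whole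
      neighbourhood, hence for analyticity at all points of \<open>W\<close>.\<close>
    have hcont: "continuous_on (V \<inter> W) (h i x)" if "i \<in> {1..H}" for i
      by (rule continuous_at_imp_continuous_on) (use isCont_real_analytic_at[OF han[OF that]] in simp)
    have zcont: "continuous_on (V \<inter> W) (z i)" if "i \<in> {1..H}" for i
      unfolding z_def using that H by (intro continuous_intros hcont) auto
    have fcont: "continuous_on (V \<inter> W) (f i)" if "i \<in> {1..H}" for i
      unfolding f_def s_eq S_def using that Spos[unfolded S_def]
      by (intro continuous_intros zcont ballI less_imp_neq[THEN not_sym]) auto
    \<comment> \<open>The comparison lemma takes a single constant for both directions, hence the
      maximum.\<close>
    have le: "C * u \<le> max C D * u" "D * u \<le> max C D * u" if "u \<ge> 0" for u
      using that by (auto intro: mult_right_mono)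
    show ?thesis
    proof (rule lct_eq_of_comparable)
      show "open (V \<inter> W)" "w0 \<in> V \<inter> W" using V assms(2,3) by auto
      show "continuous_on (V \<inter> W) (\<lambda>w. (L2_set (\<lambda>i. f i w) {1..H})\<^sup>2)"
        "continuous_on (V \<inter> W) (\<lambda>w. (L2_set (\<lambda>i. z i w) {2..H})\<^sup>2)"
        unfolding L2_set_def by (intro continuous_intros fcont zcont; simp)+
      show "max C D > 0" using C by simp
      show "\<bar>(L2_set (\<lambda>i. f i w) {1..H})\<^sup>2\<bar> \<le> max C D * \<bar>(L2_set (\<lambda>i. z i w) {2..H})\<^sup>2\<bar>"
        "\<bar>(L2_set (\<lambda>i. z i w) {2..H})\<^sup>2\<bar> \<le> max C D * \<bar>(L2_set (\<lambda>i. f i w) {1..H})\<^sup>2\<bar>"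
        if "w \<in> V \<inter> W" for w
        using V(3,4)[of w] that le by (auto intro: order_trans)
    qed
  qed
  ultimately show ?thesis unfolding f_def s_def p_def z_def by blast
qed

end
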